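(* Let $A,B,B'\in\mathbb{C}^{d\times d}$ with $BB'=B'B$, where $B$ and $B'$ have no eigenvalue in $\{1,2,3,\dots\}$. Then on $\{(x,y)\in\mathbb{C}^2: |x|+|y|<1\}$ the matrix function $U=G_1(A,B,B';x,y)$ satisfies the system $$x(1+x)U_{xx}-yU_{xy}-y^2U_{yy}+U_x(I-B)+x(A+I)U_x+xU_xB'+yU_yB'-y(A+I)U_y+AUB'=0,$$ $$y(1+y)U_{yy}-xU_{xy}-x^2U_{xx}+U_y(I-B')+y(A+I)U_y+yU_yB+xU_xB-x(A+I)U_x+AUB=0.$$
   Context: $G_1(A,B,B';x,y)=\sum_{m,n=0}^{\infty}(A)_{m+n}(B)_{n-m}(B')_{m-n}\frac{x^m y^n}{m!\,n!}$, which converges absolutely for $|x|+|y|<1$. Matrix Pochhammer symbol: for $M\in\mathbb{C}^{d\times d}$ and $n\ge1$, $(M)_0=I$, $(M)_n=M(M+I)\cdots(M+(n-1)I)$, and $(M)_{-n}=(-1)^n\big((I-M)_n\big)^{-1}$, which is defined whenever no eigenvalue of $M$ lies in $\{1,\dots,n\}$. Subscripts $x,y$ on $U$ denote partial derivatives; $A$ is not assumed to commute with $B$ or $B'$. *)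

theory Defs
  imports "HOL-Analysis.Analysis"
begin

text \<open>
  The library's \<open>(*\<^sub>R)\<close> on \<^typ>\<open>complex^'n^'m\<close> only allows real scalars, and \<open>(*s)\<close> on this type
  multiplies each row by a vector.
\<close>
definition cscale :: "complex \<Rightarrow> complex^'n^'m \<Rightarrow> complex^'n^'m"  (infixr \<open>*\<^sub>C\<close> 75)
  where "c *\<^sub>C M = (\<chi> i j. c * M $ i $ j)"

definition eigenvalue_of :: "complex^'n^'n \<Rightarrow> complex \<Rightarrow> bool"
  where "eigenvalue_of M c \<longleftrightarrow> (\<exists>v. v \<noteq> 0 \<and> M *v v = c *s v)"

primrec mpochhammer_nat :: "complex^'n^'n \<Rightarrow> nat \<Rightarrow> complex^'n^'n"
  where
    "mpochhammer_nat M 0 = mat 1"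
  | "mpochhammer_nat M (Suc n) = mpochhammer_nat M n ** (M + mat (of_nat n))"

definition mpochhammer :: "complex^'n^'n \<Rightarrow> int \<Rightarrow> complex^'n^'n"
  where "mpochhammer M k =
    (if 0 \<le> k then mpochhammer_nat M (nat k)
     else (- 1) ^ nat (- k) *\<^sub>C matrix_inv (mpochhammer_nat (mat 1 - M) (nat (- k))))"

definition G1_term ::
    "complex^'n^'n \<Rightarrow> complex^'n^'n \<Rightarrow> complex^'n^'n \<Rightarrow> complex \<Rightarrow> complex \<Rightarrow> nat \<times> nat \<Rightarrow> complex^'n^'n"
  where "G1_term A B B' x y = (\<lambda>(m, n).
    (x ^ m * y ^ n / (fact m * fact n)) *\<^sub>C
      (mpochhammer A (int m + int n) ** mpochhammer B (int n - int m) ** mpochhammer B' (int m - int n)))"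

definition G1 ::
    "complex^'n^'n \<Rightarrow> complex^'n^'n \<Rightarrow> complex^'n^'n \<Rightarrow> complex \<Rightarrow> complex \<Rightarrow> complex^'n^'n"
  where "G1 A B B' x y = infsum (G1_term A B B' x y) UNIV"

text \<open>
  Partial derivatives of a matrix function of two complex variables are taken entrywise.  Since
  \<^const>\<open>deriv\<close> is total, their existence is the separate predicate \<open>partially_differentiable\<close>.
\<close>
definition partial_x :: "(complex \<Rightarrow> complex \<Rightarrow> complex^'n^'m) \<Rightarrow> complex \<Rightarrow> complex \<Rightarrow> complex^'n^'m"
  where "partial_x F x y = (\<chi> i j. deriv (\<lambda>z. F z y $ i $ j) x)"

definition partial_y :: "(complex \<Rightarrow> complex \<Rightarrow> complex^'n^'m) \<Rightarrow> complex \<Rightarrow> complex \<Rightarrow> complex^'n^'m"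
  where "partial_y F x y = (\<chi> i j. deriv (\<lambda>z. F x z $ i $ j) y)"

definition partially_differentiable ::
    "(complex \<Rightarrow> complex \<Rightarrow> complex^'n^'m) \<Rightarrow> complex \<Rightarrow> complex \<Rightarrow> bool"
  where "partially_differentiable F x y \<longleftrightarrow>
    (\<forall>i j. (\<lambda>z. F z y $ i $ j) field_differentiable (at x) \<and>
           (\<lambda>z. F x z $ i $ j) field_differentiable (at y))"

end

theory Submission
  imports Defs
begin

text \<open>
  The function \<open>G\<^sub>1\<close> is a double power series with matrix coefficients

    \<open>c(m, n) = (A)\<^sub>m\<^sub>+\<^sub>n (B)\<^sub>n\<^sub>-\<^sub>m (B')\<^sub>m\<^sub>-\<^sub>n / (m! n!)\<close>,

  and the differential equations are recurrences for these coefficients in disguise.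

  The Pochhammer symbol satisfies \<open>(M)\<^sub>k\<^sub>+\<^sub>1 = (M + k) (M)\<^sub>k\<close> for all integers \<open>k\<close> (\<open>mpochhammer_rec\<close>); the
  condition on eigenvalues makes this meaningful for negative \<open>k\<close>. Since \<open>B\<close> and \<open>B'\<close> commute, it follows
  (\<open>G1_coeff_recurrence\<close>) that

    \<open>(m + 1) c(m + 1, n) (B + (n - m - 1)) = (A + (m + n)) c(m, n) (B' + (m - n))\<close>.

  Comparing the coefficients of \<open>x^m y^n\<close> shows that this is the first differential equation
  (\<open>matrix_series_differential_equation\<close>). The second one follows by symmetry: exchanging \<open>B\<close> and \<open>B'\<close> together
  with \<open>x\<close> and \<open>y\<close> does not change the function (\<open>G1_coeff_flip\<close>).

  Comparing coefficients requires absolute convergence and termwise differentiation. For every \<open>q > 1\<close> the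
  symbol \<open>(M)\<^sub>k\<close> is bounded by a multiple of \<open>q^k k!\<close>, and \<open>(M)\<^sub>-\<^sub>k\<close> by a multiple of \<open>q^k / k!\<close>. In \<open>c(m, n)\<close> the
  factorials of the symbols of \<open>B\<close> and \<open>B'\<close> cancel, so \<open>c(m, n)\<close> is bounded by a multiple of \<open>q^(m + n)\<close> times the
  binomial coefficient of \<open>m + n\<close> over \<open>m\<close> (\<open>matrix_diamond_summable_G1_coeff\<close>). By the binomial theorem the
  series is then dominated by a geometric series with ratio \<open>q (|x| + |y|)\<close>, which is less than 1 for suitable \<open>q\<close>
  (\<open>diamond_summableI_binomial\<close>). Series that converge absolutely on the whole region can be differentiated
  termwise, and their derivatives converge there as well (\<open>matrix_series_partial_derivatives\<close>).
\<close>

section \<open>Matrix algebra over the complex numbers\<close>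

lemma cscale_nth [simp]: "(c *\<^sub>C M) $ i $ j = c * M $ i $ j"
  by (simp add: cscale_def)

lemma cscale_one [simp]: "1 *\<^sub>C M = M"
  and cscale_zero_left [simp]: "0 *\<^sub>C M = 0"
  and cscale_cscale [simp]: "c *\<^sub>C d *\<^sub>C M = (c * d) *\<^sub>C M"
  and cscale_add_right: "c *\<^sub>C (M + N) = c *\<^sub>C M + c *\<^sub>C N"
  and cscale_diff_right: "c *\<^sub>C (M - N) = c *\<^sub>C M - c *\<^sub>C N"
  by (simp_all add: vec_eq_iff algebra_simps)

lemma cscale_matrix_mul [simp]: "(c *\<^sub>C M) ** N = c *\<^sub>C (M ** N)"
  and matrix_mul_cscale [simp]: "M ** (c *\<^sub>C N) = c *\<^sub>C (M ** N)"
  by (simp_all add: vec_eq_iff matrix_matrix_mult_def sum_distrib_left mult_ac)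

lemma matrix_add_rdistrib: "(M + N) ** P = M ** P + N ** P"
  and matrix_diff_ldistrib: "M ** (P - Q) = M ** P - M ** Q"
  and matrix_diff_rdistrib: "(M - N) ** P = M ** P - N ** P"
  for M N P Q :: "complex^'n^'n"
  by (simp_all add: vec_eq_iff matrix_matrix_mult_def algebra_simps sum.distrib sum_subtractf)

lemma matrix_mul_mat [simp]: "M ** mat c = c *\<^sub>C M"
  and mat_matrix_mul [simp]: "mat c ** M = c *\<^sub>C M"
  for M :: "complex^'n^'n"
  by (simp_all add: vec_eq_iff matrix_matrix_mult_def mat_def if_distrib if_distribR mult_ac
    cong: if_cong)

lemma bounded_linear_matrix_mul_left: "bounded_linear (\<lambda>M. X ** M)"
  and bounded_linear_matrix_mul_right: "bounded_linear (\<lambda>M. M ** X)"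
  for X :: "complex^'n^'n"
  unfolding linear_conv_bounded_linear[symmetric]
  by (rule linearI; simp add: vec_eq_iff matrix_matrix_mult_def algebra_simps sum.distrib
      scaleR_sum_right)+

lemma bounded_linear_cscale: "bounded_linear (\<lambda>M :: complex^'n^'m. c *\<^sub>C M)"
  unfolding linear_conv_bounded_linear[symmetric]
  by (rule linearI; simp add: vec_eq_iff algebra_simps)

lemma bounded_linear_entry: "bounded_linear (\<lambda>M :: complex^'n^'m. M $ i $ j)"
  unfolding linear_conv_bounded_linear[symmetric]
  by (rule linearI) simp_all

lemma matrix_inv_unique:
  fixes P Q :: "complex^'n^'n"
  assumes "P ** Q = mat 1" "Q ** P = mat 1"
  shows "matrix_inv P = Q"
proof -
  have ex: "\<exists>R. P ** R = mat 1 \<and> R ** P = mat 1"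
    using assms by blast
  have inv: "P ** matrix_inv P = mat 1"
    unfolding matrix_inv_def using someI_ex[OF ex] by simp
  have "matrix_inv P = (Q ** P) ** matrix_inv P"
    by (simp add: assms)
  also have "\<dots> = Q ** (P ** matrix_inv P)"
    by (simp only: matrix_mul_assoc)
  finally show ?thesis
    by (simp add: inv)
qed

lemma matrix_inv_works:
  fixes P :: "complex^'n^'n"
  assumes "invertible P"
  shows "P ** matrix_inv P = mat 1" "matrix_inv P ** P = mat 1"
  using assms matrix_inv_unique unfolding invertible_def by metis+

lemma matrix_inv_mult:
  fixes P Q :: "complex^'n^'n"
  assumes "invertible P" "invertible Q"
  shows "matrix_inv (P ** Q) = matrix_inv Q ** matrix_inv P"
proof (rule matrix_inv_unique)
  have "P ** Q ** (matrix_inv Q ** matrix_inv P) = P ** (Q ** matrix_inv Q) ** matrix_inv P"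
    by (simp only: matrix_mul_assoc)
  then show "P ** Q ** (matrix_inv Q ** matrix_inv P) = mat 1"
    by (simp add: matrix_inv_works assms)
  have "matrix_inv Q ** matrix_inv P ** (P ** Q) = matrix_inv Q ** (matrix_inv P ** P) ** Q"
    by (simp only: matrix_mul_assoc)
  then show "matrix_inv Q ** matrix_inv P ** (P ** Q) = mat 1"
    by (simp add: matrix_inv_works assms)
qed

lemma matrix_inv_commute:
  fixes P X :: "complex^'n^'n"
  assumes "invertible P" "X ** P = P ** X"
  shows "X ** matrix_inv P = matrix_inv P ** X"
proof -
  have "X ** matrix_inv P = (matrix_inv P ** P) ** X ** matrix_inv P"
    by (simp add: matrix_inv_works assms)
  also have "\<dots> = matrix_inv P ** (P ** X) ** matrix_inv P"
    by (simp only: matrix_mul_assoc)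
  also have "\<dots> = matrix_inv P ** (X ** P) ** matrix_inv P"
    by (simp only: assms)
  also have "\<dots> = matrix_inv P ** X ** (P ** matrix_inv P)"
    by (simp only: matrix_mul_assoc)
  finally show ?thesis
    by (simp add: matrix_inv_works assms)
qed

section \<open>The matrix Pochhammer symbol\<close>

abbreviation no_positive_integer_eigenvalue :: "complex^'n^'n \<Rightarrow> bool"
  where "no_positive_integer_eigenvalue M \<equiv> \<forall>k::nat. 1 \<le> k \<longrightarrow> \<not> eigenvalue_of M (of_nat k)"

lemma mat_vector_mul: "mat c *v v = c *s v" for c :: complex
  by (simp add: vec_eq_iff matrix_vector_mult_def mat_def if_distrib if_distribR cong: if_cong)

lemma invertible_mat_minus:
  fixes M :: "complex^'n^'n"
  assumes "\<not> eigenvalue_of M c"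
  shows "invertible (mat c - M)"
proof -
  have "v = 0" if "(mat c - M) *v v = 0" for v
    using that assms unfolding eigenvalue_of_def
    by (auto simp: matrix_vector_mult_diff_rdistrib mat_vector_mul)
  then show ?thesis
    unfolding invertible_left_inverse matrix_left_invertible_ker by blast
qed

lemma mpochhammer_factor: "mat 1 - M + mat (of_nat n) = mat (of_nat (Suc n)) - M"
  for M :: "complex^'n^'n"
  by (simp add: vec_eq_iff mat_def)

lemma invertible_mpochhammer_nat:
  fixes M :: "complex^'n^'n"
  assumes "no_positive_integer_eigenvalue M"
  shows "invertible (mpochhammer_nat (mat 1 - M) n)"
proof (induction n)
  case 0
  show ?case by (auto simp: invertible_def intro: exI[of _ "mat 1"])
next
  case (Suc n)
  then show ?case
    using assms[rule_format, of "Suc n"]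
    by (simp add: mpochhammer_factor invertible_mult invertible_mat_minus del: of_nat_Suc)
qed

lemma commute_mpochhammer_nat:
  fixes X M :: "complex^'n^'n"
  assumes "X ** M = M ** X"
  shows "X ** mpochhammer_nat M n = mpochhammer_nat M n ** X"
proof (induction n)
  case (Suc n)
  have "X ** mpochhammer_nat M (Suc n) = mpochhammer_nat M n ** X ** (M + mat (of_nat n))"
    by (simp add: matrix_mul_assoc Suc)
  also have "\<dots> = mpochhammer_nat M n ** (X ** (M + mat (of_nat n)))"
    by (simp only: matrix_mul_assoc)
  also have "X ** (M + mat (of_nat n)) = (M + mat (of_nat n)) ** X"
    by (simp add: matrix_add_ldistrib matrix_add_rdistrib assms)
  finally show ?case
    by (simp add: matrix_mul_assoc)
qed simp

lemma commute_mpochhammer: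
  fixes X M :: "complex^'n^'n"
  assumes "no_positive_integer_eigenvalue M" "X ** M = M ** X"
  shows "X ** mpochhammer M k = mpochhammer M k ** X"
proof -
  have "X ** (mat 1 - M) = (mat 1 - M) ** X"
    by (simp add: matrix_diff_ldistrib matrix_diff_rdistrib assms)
  then show ?thesis
    unfolding mpochhammer_def
    by (simp add: commute_mpochhammer_nat matrix_inv_commute invertible_mpochhammer_nat assms)
qed

lemma mpochhammer_of_nat: "mpochhammer M (int n) = mpochhammer_nat M n"
  by (simp add: mpochhammer_def)

lemma mpochhammer_of_nat_Suc:
  "mpochhammer M (int (Suc n)) = mpochhammer M (int n) ** (M + mat (of_nat n))"
  by (simp only: mpochhammer_of_nat mpochhammer_nat.simps)

lemma mpochhammer_minus_of_nat:
  fixes M :: "complex^'n^'n"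
  shows "mpochhammer M (- int n) = (- 1) ^ n *\<^sub>C matrix_inv (mpochhammer_nat (mat 1 - M) n)"
proof (cases n)
  case 0
  have "matrix_inv (mat 1) = (mat 1 :: complex^'n^'n)"
    by (rule matrix_inv_unique) simp_all
  then show ?thesis by (simp add: 0 mpochhammer_def)
qed (simp add: mpochhammer_def nat_add_distrib)

text \<open>
  For negative indices the symbol is a product of inverses \<open>(M - j)^(-1)\<close> for \<open>1 \<le> j \<le> n\<close>, because the sign
  \<open>(- 1)^n\<close> turns each factor \<open>j - M\<close> into \<open>M - j\<close>. Multiplying by \<open>M - (n + 1)\<close> therefore cancels one factor.
\<close>
lemma mpochhammer_minus_Suc:
  fixes M :: "complex^'n^'n"
  assumes "no_positive_integer_eigenvalue M"
  shows "(M - mat (of_nat (Suc n))) ** mpochhammer M (- int (Suc n)) = mpochhammer M (- int n)"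
proof -
  let ?E = "mat (of_nat (Suc n)) - M" and ?P = "mpochhammer_nat (mat 1 - M) n"
  have E: "invertible ?E"
    using assms by (intro invertible_mat_minus) (simp del: of_nat_Suc)
  have neg: "(M - mat (of_nat (Suc n))) ** X = (-1) *\<^sub>C (?E ** X)" for X :: "complex^'n^'n"
    unfolding matrix_diff_rdistrib by (simp add: vec_eq_iff)
  have "?E ** (matrix_inv ?E ** matrix_inv ?P) = matrix_inv ?P"
    by (simp add: matrix_mul_assoc matrix_inv_works E del: of_nat_Suc)
  moreover have "mpochhammer_nat (mat 1 - M) (Suc n) = ?P ** ?E"
    by (simp only: mpochhammer_nat.simps mpochhammer_factor)
  ultimately show ?thesis
    unfolding mpochhammer_minus_of_nat neg
    by (simp add: matrix_inv_mult E invertible_mpochhammer_nat[OF assms] del: mpochhammer_nat.simps of_nat_Suc mat_matrix_mul)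
qed

text \<open>
  One recurrence covers both definitions of the symbol; at \<open>k = -1\<close> it joins them. It is the only
  property of the symbols of \<open>B\<close> and \<open>B'\<close>, besides commutation, that the differential equations use.
\<close>
lemma mpochhammer_rec:
  fixes M :: "complex^'n^'n"
  assumes "no_positive_integer_eigenvalue M"
  shows "mpochhammer M (k + 1) = (M + mat (of_int k)) ** mpochhammer M k"
proof (cases "0 \<le> k")
  case True
  then obtain n where k: "k = int n"
    using nonneg_int_cases by metis
  have "(M + mat (of_nat n)) ** M = M ** (M + mat (of_nat n))"
    by (simp add: matrix_add_ldistrib matrix_add_rdistrib)
  then show ?thesis
    using mpochhammer_of_nat_Suc[of M n] commute_mpochhammer_nat[of "M + mat (of_nat n)" M n]
    by (simp add: k mpochhammer_of_nat add.commute)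
next
  case False
  then obtain n where k: "k = - int (Suc n)"
    by (cases k rule: int_cases) auto
  then have "k + 1 = - int n" by simp
  moreover have "M + mat (of_int k) = M - mat (of_nat (Suc n))"
    by (simp add: k vec_eq_iff mat_def)
  ultimately show ?thesis
    using mpochhammer_minus_Suc[OF assms, of n] k by (simp only:)
qed

section \<open>Growth of Pochhammer symbols\<close>

text \<open>
  A ratio test that keeps an explicit constant: once the ratios are below \<open>q\<close> each further step costs
  a factor of at most \<open>q\<close>, and \<open>K\<close> absorbs the finitely many earlier terms.
\<close>
lemma subexponential_growth:
  fixes a r :: "nat \<Rightarrow> real" and q :: real
  assumes nonneg: "\<And>k. 0 \<le> a k"
    and step: "eventually (\<lambda>k. a (Suc k) \<le> a k * r k) sequentially"
    and r: "r \<longlonglongrightarrow> 1" and "1 < q"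
  obtains K where "0 \<le> K" "\<And>k. a k \<le> K * q ^ k"
proof -
  have "eventually (\<lambda>k. r k < q) sequentially"
    using r \<open>1 < q\<close> by (rule order_tendstoD)
  with step have "eventually (\<lambda>k. a (Suc k) \<le> q * a k) sequentially"
  proof eventually_elim
    case (elim k)
    have "a k * r k \<le> a k * q"
      using elim nonneg[of k] by (intro mult_left_mono) auto
    with elim show ?case by (simp add: mult.commute)
  qed
  then obtain N where N: "\<And>k. N \<le> k \<Longrightarrow> a (Suc k) \<le> q * a k"
    unfolding eventually_sequentially by blast
  \<comment> \<open>The sum dominates every term up to \<open>N\<close>, including the last one, from which the geometric
     estimate takes over.\<close>
  define K where "K = (\<Sum>k\<le>N. a k)"
  have K: "0 \<le> K"
    by (simp add: K_def nonneg sum_nonneg)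
  have "a k \<le> K * q ^ k" for k
  proof (induction k)
    case 0
    show ?case
      unfolding K_def using member_le_sum[of 0 "{..N}" a] nonneg by simp
  next
    case (Suc k)
    show ?case
    proof (cases "N \<le> k")
      case True
      have "a (Suc k) \<le> q * a k" by (rule N[OF True])
      also have "\<dots> \<le> q * (K * q ^ k)"
        using Suc \<open>1 < q\<close> by simp
      finally show ?thesis by (simp add: mult_ac)
    next
      case False
      have "a (Suc k) \<le> K"
        unfolding K_def using False nonneg by (intro member_le_sum) auto
      also have "\<dots> \<le> K * q ^ Suc k"
        using K one_le_power[of q "Suc k"] \<open>1 < q\<close> mult_left_mono[of 1 "q ^ Suc k" K] by simp
      finally show ?thesis .
    qed
  qed
  with K show thesis by (rule that)
qed

lemma shifted_ratio_tendsto: "(\<lambda>k. (c + real k) / (real k + 1)) \<longlonglongrightarrow> 1"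
proof -
  have "(\<lambda>k. 1 + (c - 1) * inverse (real (Suc k))) \<longlonglongrightarrow> 1 + (c - 1) * 0"
    by (intro tendsto_intros LIMSEQ_inverse_real_of_nat)
  moreover have "1 + (c - 1) * inverse (real (Suc k)) = (c + real k) / (real k + 1)" for k
    by (simp add: field_simps)
  ultimately show ?thesis by simp
qed

text \<open>
  The growth estimates compare ratios with 1 and so need a norm that is submultiplicative with constant
  exactly 1, and for which \<open>M + k\<close> has norm at most \<open>|M| + k\<close>. The operator norm has both properties.
\<close>
abbreviation opnorm :: "complex^'n^'m \<Rightarrow> real"
  where "opnorm M \<equiv> onorm ((*v) M)"

lemma opnorm_nonneg: "0 \<le> opnorm (M :: complex^'n^'m)"
  by (rule onorm_pos_le) simp

lemma norm_mult_vec_le: "norm (M *v v) \<le> opnorm M * norm v" for M :: "complex^'n^'m"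
  by (rule onorm) simp

lemma opnorm_matrix_mul: "opnorm (M ** N) \<le> opnorm M * opnorm N"
  for M :: "complex^'n^'m" and N :: "complex^'k^'n"
proof -
  have "(*v) (M ** N) = (*v) M \<circ> (*v) N"
    by (simp add: fun_eq_iff matrix_vector_mul_assoc)
  then show ?thesis
    by (simp add: onorm_compose)
qed

lemma norm_entry_le_opnorm: "norm (M $ i $ j) \<le> opnorm M" for M :: "complex^'n^'m"
proof -
  have "norm (M $ i $ j) = norm ((M *v axis j 1) $ i)"
    by (simp add: matrix_vector_mult_def axis_def if_distrib cong: if_cong)
  also have "\<dots> \<le> norm (M *v axis j 1)"
    by (rule Finite_Cartesian_Product.norm_nth_le)
  also have "\<dots> \<le> opnorm M * norm (axis j 1 :: complex^'n)"
    by (rule norm_mult_vec_le)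
  finally show ?thesis by simp
qed

lemma norm_scalar_vec: "norm (c *s v) = norm c * norm v" for v :: "complex^'n"
  by (simp add: norm_vec_def norm_mult L2_set_right_distrib)

lemma mat_plus_vec: "(M + mat c) *v v = M *v v + c *s v" for M :: "complex^'n^'n"
  by (simp add: matrix_vector_mult_add_rdistrib mat_vector_mul)

text \<open>
  Dividing by \<open>k!\<close> leaves a sequence whose consecutive ratios are at most \<open>(|M| + k) / (k + 1)\<close>, which tends to 1.
\<close>
lemma mpochhammer_of_nat_growth:
  fixes M :: "complex^'n^'n"
  assumes "1 < q"
  obtains K where "0 \<le> K" "\<And>k. opnorm (mpochhammer M (int k)) \<le> K * q ^ k * fact k"
proof -
  define a where "a k = opnorm (mpochhammer M (int k)) / fact k" for k
  define r where "r k = (opnorm M + real k) / (real k + 1)" for k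
  have "a (Suc k) \<le> a k * r k" for k
  proof -
    have "opnorm (M + mat (of_nat k)) \<le> opnorm M + real k"
    proof (rule onorm_le)
      fix v :: "complex^'n"
      have "norm ((M + mat (of_nat k)) *v v) \<le> norm (M *v v) + norm (of_nat k *s v :: complex^'n)"
        unfolding mat_plus_vec by (rule norm_triangle_ineq)
      also have "\<dots> \<le> (opnorm M + real k) * norm v"
        using norm_mult_vec_le[of M v] by (simp add: norm_scalar_vec algebra_simps)
      finally show "norm ((M + mat (of_nat k)) *v v) \<le> (opnorm M + real k) * norm v" .
    qed
    then have "opnorm (mpochhammer M (int k)) * opnorm (M + mat (of_nat k))
        \<le> opnorm (mpochhammer M (int k)) * (opnorm M + real k)"
      by (intro mult_left_mono opnorm_nonneg)
    with opnorm_matrix_mul[of "mpochhammer M (int k)" "M + mat (of_nat k)"]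
    have "opnorm (mpochhammer M (int (Suc k))) \<le> opnorm (mpochhammer M (int k)) * (opnorm M + real k)"
      unfolding mpochhammer_of_nat_Suc by linarith
    then have "a (Suc k) \<le> opnorm (mpochhammer M (int k)) * (opnorm M + real k) / fact (Suc k)"
      unfolding a_def by (rule divide_right_mono) simp
    also have "\<dots> = a k * r k"
      by (simp add: a_def r_def mult_ac add_ac)
    finally show ?thesis .
  qed
  moreover have "0 \<le> a k" for k
    by (simp add: a_def opnorm_nonneg)
  moreover have "r \<longlonglongrightarrow> 1"
    unfolding r_def by (rule shifted_ratio_tendsto)
  ultimately obtain K where "0 \<le> K" "\<And>k. a k \<le> K * q ^ k"
    using subexponential_growth[of a r q] assms by auto
  then show thesis
    by (intro that) (auto simp: a_def divide_simps)
qed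

text \<open>
  For \<open>j > |M|\<close> the inverse of \<open>M - j\<close> has operator norm at most \<open>1 / (j - |M|)\<close>, because
  \<open>M - j\<close> stretches every vector by at least \<open>j - |M|\<close>. After multiplication with \<open>k!\<close> the consecutive ratios
  are at most \<open>(k + 1) / (k + 1 - |M|)\<close>, which again tends to 1.
\<close>
lemma mpochhammer_minus_of_nat_growth:
  fixes M :: "complex^'n^'n"
  assumes M: "no_positive_integer_eigenvalue M" and "1 < q"
  obtains K where "0 \<le> K" "\<And>k. opnorm (mpochhammer M (- int k)) \<le> K * q ^ k / fact k"
proof -
  define a where "a k = opnorm (mpochhammer M (- int k)) * fact k" for k
  define r where "r k = (real k + 1) / (real k + 1 - opnorm M)" for k
  have "a (Suc k) \<le> a k * r k" if k: "opnorm M < real k + 1" for k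
  proof -
    have "opnorm (mpochhammer M (- int (Suc k)))
        \<le> opnorm (mpochhammer M (- int k)) / (real k + 1 - opnorm M)"
    proof (rule onorm_le)
      fix v :: "complex^'n"
      let ?w = "mpochhammer M (- int (Suc k)) *v v"
      have "mpochhammer M (- int k) *v v = M *v ?w - of_nat (Suc k) *s ?w"
        unfolding mpochhammer_minus_Suc[OF M, of k, symmetric]
        by (simp add: matrix_vector_mul_assoc[symmetric] matrix_vector_mult_diff_rdistrib
            mat_vector_mul del: of_nat_Suc)
      then have "norm (of_nat (Suc k) *s ?w) - norm (M *v ?w) \<le> norm (mpochhammer M (- int k) *v v)"
        by (metis norm_minus_commute norm_triangle_ineq2)
      moreover have "norm (of_nat (Suc k) *s ?w) = (real k + 1) * norm ?w"
        by (simp add: norm_scalar_vec del: of_nat_Suc)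
      ultimately have "(real k + 1 - opnorm M) * norm ?w \<le> opnorm (mpochhammer M (- int k)) * norm v"
        using norm_mult_vec_le[of M ?w] norm_mult_vec_le[of "mpochhammer M (- int k)" v]
        by (simp add: left_diff_distrib)
      then show "norm ?w \<le> opnorm (mpochhammer M (- int k)) / (real k + 1 - opnorm M) * norm v"
        using k by (simp add: divide_simps mult_ac)
    qed
    then have "a (Suc k) \<le> opnorm (mpochhammer M (- int k)) / (real k + 1 - opnorm M) * fact (Suc k)"
      unfolding a_def by (rule mult_right_mono) simp
    also have "\<dots> = a k * r k"
      by (simp add: a_def r_def mult_ac add_ac)
    finally show ?thesis .
  qed
  moreover have "eventually (\<lambda>k. opnorm M < real k + 1) sequentially"
    using filterlim_real_sequentially[unfolded filterlim_at_top_dense, THEN spec, of "opnorm M"]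
    by eventually_elim simp
  ultimately have "eventually (\<lambda>k. a (Suc k) \<le> a k * r k) sequentially"
    by (simp add: eventually_mono)
  moreover have "0 \<le> a k" for k
    by (simp add: a_def opnorm_nonneg)
  moreover have "r \<longlonglongrightarrow> 1"
    using tendsto_inverse[OF shifted_ratio_tendsto[of "- opnorm M + 1"]]
    unfolding r_def by (simp add: algebra_simps)
  ultimately obtain K where "0 \<le> K" "\<And>k. a k \<le> K * q ^ k"
    using subexponential_growth[of a r q] assms by auto
  then show thesis
    by (intro that) (auto simp: a_def divide_simps)
qed

text \<open>
  In the coefficients of \<open>G\<^sub>1\<close> the indices of the symbols of \<open>B\<close> and \<open>B'\<close> are opposite, so the factorial growth
  of one of them cancels against the factorial decay of the other.
\<close>
lemma opposite_mpochhammer_growth: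
  fixes M N :: "complex^'n^'n"
  assumes M: "no_positive_integer_eigenvalue M" and N: "no_positive_integer_eigenvalue N" and "1 < q"
  obtains K where "0 \<le> K"
    "\<And>k. opnorm (mpochhammer M k) * opnorm (mpochhammer N (- k)) \<le> K * q ^ (2 * nat \<bar>k\<bar>)"
proof -
  obtain K1 where K1: "0 \<le> K1" "\<And>k. opnorm (mpochhammer M (int k)) \<le> K1 * q ^ k * fact k"
    using mpochhammer_of_nat_growth \<open>1 < q\<close> by metis
  obtain K2 where K2: "0 \<le> K2" "\<And>k. opnorm (mpochhammer N (int k)) \<le> K2 * q ^ k * fact k"
    using mpochhammer_of_nat_growth \<open>1 < q\<close> by metis
  obtain L1 where L1: "0 \<le> L1" "\<And>k. opnorm (mpochhammer M (- int k)) \<le> L1 * q ^ k / fact k"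
    using mpochhammer_minus_of_nat_growth M \<open>1 < q\<close> by metis
  obtain L2 where L2: "0 \<le> L2" "\<And>k. opnorm (mpochhammer N (- int k)) \<le> L2 * q ^ k / fact k"
    using mpochhammer_minus_of_nat_growth N \<open>1 < q\<close> by metis
  have pos: "0 < q ^ m" for m :: nat
    using \<open>1 < q\<close> by simp
  have "opnorm (mpochhammer M k) * opnorm (mpochhammer N (- k))
      \<le> (K1 * L2 + L1 * K2) * q ^ (2 * nat \<bar>k\<bar>)" for k
  proof (cases k rule: int_cases2)
    case (nonneg n)
    have "opnorm (mpochhammer M (int n)) * opnorm (mpochhammer N (- int n))
        \<le> (K1 * q ^ n * fact n) * (L2 * q ^ n / fact n)"
      using \<open>1 < q\<close> K1 by (intro mult_mono K1 L2 opnorm_nonneg) auto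
    also have "\<dots> = K1 * L2 * q ^ (2 * n)"
      by (simp add: mult_2 power_add)
    also have "\<dots> \<le> (K1 * L2 + L1 * K2) * q ^ (2 * n)"
      using K2 L1 pos by (intro mult_right_mono) (auto simp: less_imp_le)
    finally show ?thesis by (simp add: nonneg)
  next
    case (nonpos n)
    have "opnorm (mpochhammer M (- int n)) * opnorm (mpochhammer N (int n))
        \<le> (L1 * q ^ n / fact n) * (K2 * q ^ n * fact n)"
      using \<open>1 < q\<close> L1 by (intro mult_mono K2 L1 opnorm_nonneg) auto
    also have "\<dots> = L1 * K2 * q ^ (2 * n)"
      by (simp add: mult_2 power_add)
    also have "\<dots> \<le> (K1 * L2 + L1 * K2) * q ^ (2 * n)"
      using K1 L2 pos by (intro mult_right_mono) (auto simp: less_imp_le)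
    finally show ?thesis by (simp add: nonpos)
  qed
  moreover have "0 \<le> K1 * L2 + L1 * K2"
    using K1 K2 L1 L2 by simp
  ultimately show thesis
    using that by blast
qed

section \<open>Double power series on the unit diamond\<close>

text \<open>
  The region \<open>|x| + |y| < 1\<close> depends only on the absolute values of the variables. Convergence on all of it is
  a property of the coefficients alone, and it is preserved by differentiation.
\<close>
definition diamond_summable :: "(nat \<Rightarrow> nat \<Rightarrow> complex) \<Rightarrow> bool"
  where "diamond_summable c \<longleftrightarrow>
    (\<forall>x y. norm x + norm y < 1 \<longrightarrow> (\<lambda>p. norm (case p of (m, n) \<Rightarrow> c m n * (x ^ m * y ^ n))) summable_on UNIV)"

definition double_series :: "(nat \<Rightarrow> nat \<Rightarrow> complex) \<Rightarrow> complex \<Rightarrow> complex \<Rightarrow> complex"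
  where "double_series c x y = (\<Sum>\<^sub>\<infinity>(m, n). c m n * (x ^ m * y ^ n))"

lemma diamond_summableD:
  assumes "diamond_summable c" "norm x + norm y < 1"
  shows "(\<lambda>p. norm (case p of (m, n) \<Rightarrow> c m n * (x ^ m * y ^ n))) summable_on UNIV"
  using assms unfolding diamond_summable_def by blast

text \<open>
  The factor \<open>m + 1\<close> produced by differentiation costs an arbitrarily small enlargement of \<open>|x|\<close>: for
  \<open>|x| < s\<close> the quotients \<open>(m + 1) |x|^m / s^(m + 1)\<close> are bounded, and \<open>s\<close> can be chosen with \<open>s + |y| < 1\<close>.
\<close>
lemma diamond_summable_diff_left:
  assumes "diamond_summable c"
  shows "diamond_summable (\<lambda>m n. of_nat (Suc m) * c (Suc m) n)"
  unfolding diamond_summable_def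
proof (intro allI impI)
  fix x y :: complex
  assume xy: "norm x + norm y < 1"
  then obtain s where s: "norm x < s" "s < 1 - norm y"
    using dense[of "norm x" "1 - norm y"] by auto
  have s0: "0 < s"
    using s(1) norm_ge_zero[of x] by linarith
  define t where "t = norm x / s"
  have t: "0 \<le> t" "t < 1"
    using s s0 by (auto simp: t_def)
  have "(\<lambda>m. of_nat m * t ^ m) \<longlonglongrightarrow> 0"
    using t by (intro powser_times_n_limit_0) auto
  then have "Bseq (\<lambda>m. of_nat m * t ^ m)"
    using convergentI convergent_imp_Bseq by blast
  then obtain L where L: "\<And>m. norm (of_nat m * t ^ m) \<le> L"
    unfolding Bseq_def by blast
  define K where "K = (L + 1) / s"
  have bound: "real (Suc m) * norm x ^ m \<le> K * s ^ Suc m" for m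
  proof -
    have "real (Suc m) * t ^ m \<le> L + 1"
      using L[of m] t power_le_one[of t m] by (simp add: algebra_simps)
    then have "real (Suc m) * t ^ m * s ^ m \<le> (L + 1) * s ^ m"
      using s0 by (intro mult_right_mono) auto
    then show ?thesis
      using s0 by (simp add: K_def t_def power_divide)
  qed
  have "0 \<le> K"
    using bound[of 0] s0 zero_less_mult_pos2[of K s] by simp
  let ?f = "\<lambda>(m, n). c m n * (of_real s ^ m * y ^ n)"
  have "(\<lambda>p. norm (?f p)) summable_on UNIV"
    using s s0 by (intro diamond_summableD assms) auto
  then have "(\<lambda>p. norm (?f p)) summable_on ((\<lambda>(m, n). (Suc m, n)) ` UNIV)"
    by (rule summable_on_subset_banach) simp
  then have "((\<lambda>p. norm (?f p)) \<circ> (\<lambda>(m, n). (Suc m, n))) summable_on UNIV"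
    by (rule summable_on_reindex[THEN iffD1, rotated]) (auto simp: inj_on_def)
  then have sum: "(\<lambda>p. norm (case p of (m, n) \<Rightarrow> of_real K * (c (Suc m) n * (of_real s ^ Suc m * y ^ n)))) summable_on UNIV"
    by (auto simp: o_def case_prod_unfold norm_mult intro: summable_on_cmult_right)
  show "(\<lambda>p. norm (case p of (m, n) \<Rightarrow> of_nat (Suc m) * c (Suc m) n * (x ^ m * y ^ n))) summable_on UNIV"
  proof (rule Infinite_Sum.abs_summable_on_comparison_test[OF sum], clarify)
    fix m n
    have "norm (of_nat (Suc m) * c (Suc m) n * (x ^ m * y ^ n))
        = (real (Suc m) * norm x ^ m) * (norm (c (Suc m) n) * norm y ^ n)"
      by (simp add: norm_mult norm_power del: of_nat_Suc)
    also have "\<dots> \<le> (K * s ^ Suc m) * (norm (c (Suc m) n) * norm y ^ n)"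
      by (intro mult_right_mono bound) auto
    also have "\<dots> = norm (of_real K * (c (Suc m) n * (of_real s ^ Suc m * y ^ n)))"
      using \<open>0 \<le> K\<close> s0 by (simp add: norm_mult norm_power mult_ac)
    finally show "norm (of_nat (Suc m) * c (Suc m) n * (x ^ m * y ^ n))
        \<le> norm (of_real K * (c (Suc m) n * (of_real s ^ Suc m * y ^ n)))" .
  qed
qed

lemma double_series_as_power_series:
  assumes "diamond_summable c" "norm x + norm y < 1"
  shows "(\<lambda>m. (\<Sum>\<^sub>\<infinity>n. c m n * y ^ n) * x ^ m) sums double_series c x y"
proof -
  have eq: "(\<Sum>\<^sub>\<infinity>n. c m n * (x ^ m * y ^ n)) = (\<Sum>\<^sub>\<infinity>n. c m n * y ^ n) * x ^ m" for m
    by (subst infsum_cmult_left'[symmetric]) (simp add: mult_ac)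
  have sm: "(\<lambda>(m, n). c m n * (x ^ m * y ^ n)) summable_on (UNIV \<times> UNIV)"
    using diamond_summableD[OF assms] Infinite_Sum.abs_summable_summable by (simp add: UNIV_Times_UNIV)
  have "((\<lambda>m. (\<Sum>\<^sub>\<infinity>n. c m n * (x ^ m * y ^ n))) has_sum double_series c x y) UNIV"
    using summable_on_Sigma_banach[OF sm] infsum_Sigma'_banach[OF sm]
    by (simp add: has_sum_infsum double_series_def has_sum_iff)
  then show ?thesis
    unfolding eq by (rule has_sum_imp_sums)
qed

text \<open>
  Summing over \<open>n\<close> first turns the series into a power series in \<open>x\<close> with coefficients depending on \<open>y\<close>,
  which can be differentiated term by term.
\<close>
lemma double_series_has_field_derivative_left:
  assumes c: "diamond_summable c" and xy: "norm x + norm y < 1"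
  shows "((\<lambda>z. double_series c z y) has_field_derivative
    double_series (\<lambda>m n. of_nat (Suc m) * c (Suc m) n) x y) (at x)"
proof -
  define g where "g m = (\<Sum>\<^sub>\<infinity>n. c m n * y ^ n)" for m
  have g: "(\<lambda>m. g m * z ^ m) sums double_series c z y" if "norm z < 1 - norm y" for z
    unfolding g_def using that by (intro double_series_as_power_series c) simp
  have x: "norm x < 1 - norm y"
    using xy by simp
  have "((\<lambda>z. \<Sum>m. g m * z ^ m) has_field_derivative (\<Sum>m. diffs g m * x ^ m)) (at x)"
    using x by (rule termdiffs_strong'[rotated]) (use g in \<open>auto simp: sums_iff\<close>)
  moreover have "(\<Sum>m. diffs g m * x ^ m) = double_series (\<lambda>m n. of_nat (Suc m) * c (Suc m) n) x y"
  proof -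
    have "diffs g m = (\<Sum>\<^sub>\<infinity>n. of_nat (Suc m) * c (Suc m) n * y ^ n)" for m
      unfolding diffs_def g_def by (subst infsum_cmult_right'[symmetric]) (simp only: mult_ac)
    then show ?thesis
      using double_series_as_power_series[OF diamond_summable_diff_left[OF c] xy]
      by (simp add: sums_iff)
  qed
  moreover have "eventually (\<lambda>z. (\<Sum>m. g m * z ^ m) = double_series c z y) (nhds x)"
  proof -
    have "eventually (\<lambda>z. z \<in> ball 0 (1 - norm y)) (nhds x)"
      using x by (intro eventually_nhds_in_open) auto
    then show ?thesis
      by eventually_elim (use g in \<open>auto simp: sums_iff\<close>)
  qed
  ultimately show ?thesis
    by (simp only: DERIV_cong_ev[of x x "\<lambda>z. \<Sum>m. g m * z ^ m" "\<lambda>z. double_series c z y"])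
qed

text \<open>
  Exchanging the two indices exchanges the two variables; this transfers every statement about \<open>x\<close> to \<open>y\<close>.
\<close>
lemma diamond_summable_flip: "diamond_summable (\<lambda>m n. c n m) \<longleftrightarrow> diamond_summable c"
proof -
  have "diamond_summable (\<lambda>m n. c n m)" if c: "diamond_summable c" for c
    unfolding diamond_summable_def
  proof (intro allI impI)
    fix x y :: complex
    assume "norm x + norm y < 1"
    then have "(\<lambda>p. norm (case p of (m, n) \<Rightarrow> c m n * (y ^ m * x ^ n))) summable_on UNIV"
      by (intro diamond_summableD c) simp
    then have "(\<lambda>p. norm ((\<lambda>(m, n). c m n * (y ^ m * x ^ n)) (prod.swap p))) summable_on UNIV"
      by (rule summable_on_reindex_bij_betw[OF bij_swap, THEN iffD2])
    then show "(\<lambda>p. norm (case p of (m, n) \<Rightarrow> c n m * (x ^ m * y ^ n))) summable_on UNIV"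
      by (simp add: case_prod_unfold mult.commute)
  qed
  from this[of c] this[of "\<lambda>m n. c n m"] show ?thesis by blast
qed

lemma double_series_flip: "double_series (\<lambda>m n. c n m) x y = double_series c y x"
proof -
  have "double_series (\<lambda>m n. c n m) x y
      = (\<Sum>\<^sub>\<infinity>p. (\<lambda>(m, n). c m n * (y ^ m * x ^ n)) (prod.swap p))"
    by (simp add: double_series_def case_prod_unfold mult.commute)
  also have "\<dots> = double_series c y x"
    unfolding double_series_def by (rule infsum_reindex_bij_betw[OF bij_swap])
  finally show ?thesis .
qed

lemma diamond_summable_diff_right:
  assumes "diamond_summable c"
  shows "diamond_summable (\<lambda>m n. of_nat (Suc n) * c m (Suc n))"
proof -
  have "diamond_summable (\<lambda>m n. of_nat (Suc m) * c n (Suc m))"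
    using assms by (intro diamond_summable_diff_left) (simp only: diamond_summable_flip[of c])
  then show ?thesis
    by (simp only: diamond_summable_flip[of "\<lambda>m n. of_nat (Suc n) * c m (Suc n)"])
qed

lemma double_series_has_field_derivative_right:
  assumes c: "diamond_summable c" and xy: "norm x + norm y < 1"
  shows "(double_series c x has_field_derivative
    double_series (\<lambda>m n. of_nat (Suc n) * c m (Suc n)) x y) (at y)"
proof -
  have "((\<lambda>z. double_series (\<lambda>m n. c n m) z x) has_field_derivative
      double_series (\<lambda>m n. of_nat (Suc m) * c n (Suc m)) y x) (at y)"
    using xy c diamond_summable_flip[of c]
    by (intro double_series_has_field_derivative_left) auto
  then show ?thesis
    unfolding double_series_flip[of c]
      double_series_flip[of "\<lambda>m n. of_nat (Suc n) * c m (Suc n)"] .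
qed

text \<open>
  Along the diagonal \<open>m + n = N\<close> the binomial theorem sums the bounds to \<open>(q (|x| + |y|))^N\<close>, up to the constant.
  For \<open>q\<close> close to 1 this is the general term of a convergent geometric series, so the binomial
  coefficients alone determine the region of convergence.
\<close>
lemma diamond_summableI_binomial:
  assumes "\<And>q. 1 < q \<Longrightarrow> \<exists>K. \<forall>m n. norm (c m n) \<le> K * q ^ (m + n) * real ((m + n) choose m)"
  shows "diamond_summable c"
  unfolding diamond_summable_def
proof (intro allI impI)
  fix x y :: complex
  assume xy: "norm x + norm y < 1"
  obtain q where q: "1 < q" "q * (norm x + norm y) < 1"
  proof (cases "norm x + norm y = 0")
    case True
    then show ?thesis by (intro that[of 2]) auto
  next
    case False
    then have pos: "0 < norm x + norm y"
      by (metis add_nonneg_nonneg norm_ge_zero order_le_less)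
    then have "1 < 1 / (norm x + norm y)"
      using xy by simp
    then obtain q where "1 < q" "q < 1 / (norm x + norm y)"
      using dense by blast
    with pos show ?thesis
      by (intro that[of q]) (auto simp: pos_less_divide_eq)
  qed
  obtain K where K: "\<And>m n. norm (c m n) \<le> K * q ^ (m + n) * real ((m + n) choose m)"
    using assms[OF q(1)] by blast
  define X Y where "X = q * norm x" and "Y = q * norm y"
  have XY: "0 \<le> X" "0 \<le> Y" "X + Y < 1"
    using q by (auto simp: X_def Y_def algebra_simps)
  let ?b = "\<lambda>(m, n). real ((m + n) choose m) * X ^ m * Y ^ n"
  have sum: "(\<lambda>(N, k). real (N choose k) * X ^ k * Y ^ (N - k)) summable_on (SIGMA N:UNIV. {..N})"
  proof (rule summable_on_SigmaI)
    show "((\<lambda>k. case (N, k) of (N, k) \<Rightarrow> real (N choose k) * X ^ k * Y ^ (N - k)) has_sum (X + Y) ^ N) {..N}"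
      for N
      by (simp add: binomial_ring has_sum_finite)
    show "(\<lambda>N. (X + Y) ^ N) summable_on UNIV"
      using XY by (subst summable_on_UNIV_nonneg_real_iff) (auto intro!: summable_geometric)
  qed (use XY in auto)
  have "?b summable_on UNIV"
    by (subst summable_on_reindex_bij_witness[where S = UNIV and i = "\<lambda>(N, k). (k, N - k)"
          and j = "\<lambda>(m, n). (m + n, m)"]) (use sum in auto)
  then have sm: "(\<lambda>p. K * ?b p) summable_on UNIV"
    by (rule summable_on_cmult_right)
  show "(\<lambda>p. norm (case p of (m, n) \<Rightarrow> c m n * (x ^ m * y ^ n))) summable_on UNIV"
  proof (rule Infinite_Sum.abs_summable_on_comparison_test'[OF sm], clarify)
    fix m n
    have "norm (c m n * (x ^ m * y ^ n)) = norm (c m n) * (norm x ^ m * norm y ^ n)"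
      by (simp add: norm_mult norm_power)
    also have "\<dots> \<le> K * q ^ (m + n) * real ((m + n) choose m) * (norm x ^ m * norm y ^ n)"
      by (intro mult_right_mono K) auto
    also have "\<dots> = K * (real ((m + n) choose m) * X ^ m * Y ^ n)"
      by (simp add: X_def Y_def power_add power_mult_distrib mult_ac)
    finally show "norm (c m n * (x ^ m * y ^ n)) \<le> K * (real ((m + n) choose m) * X ^ m * Y ^ n)" .
  qed
qed

section \<open>Matrix-valued double series\<close>

definition matrix_series :: "(nat \<Rightarrow> nat \<Rightarrow> complex^'n^'m) \<Rightarrow> complex \<Rightarrow> complex \<Rightarrow> complex^'n^'m"
  where "matrix_series C x y = (\<Sum>\<^sub>\<infinity>(m, n). (x ^ m * y ^ n) *\<^sub>C C m n)"

definition matrix_diamond_summable :: "(nat \<Rightarrow> nat \<Rightarrow> complex^'n^'m) \<Rightarrow> bool"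
  where "matrix_diamond_summable C \<longleftrightarrow> (\<forall>i j. diamond_summable (\<lambda>m n. C m n $ i $ j))"

definition diff_left :: "(nat \<Rightarrow> nat \<Rightarrow> complex^'n^'m) \<Rightarrow> nat \<Rightarrow> nat \<Rightarrow> complex^'n^'m"
  where "diff_left C m n = of_nat (Suc m) *\<^sub>C C (Suc m) n"

definition diff_right :: "(nat \<Rightarrow> nat \<Rightarrow> complex^'n^'m) \<Rightarrow> nat \<Rightarrow> nat \<Rightarrow> complex^'n^'m"
  where "diff_right C m n = of_nat (Suc n) *\<^sub>C C m (Suc n)"

lemma norm_matrix_le_sum: "norm M \<le> (\<Sum>i\<in>UNIV. \<Sum>j\<in>UNIV. norm (M $ i $ j))" for M :: "complex^'n^'m"
proof -
  have "norm M \<le> (\<Sum>i\<in>UNIV. norm (M $ i))"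
    unfolding norm_vec_def[of M] by (rule L2_set_le_sum) simp
  also have "\<dots> \<le> (\<Sum>i\<in>UNIV. \<Sum>j\<in>UNIV. norm (M $ i $ j))"
    unfolding norm_vec_def by (intro sum_mono L2_set_le_sum) simp
  finally show ?thesis .
qed

lemma summable_on_finite_sum:
  fixes f :: "'i \<Rightarrow> 'a \<Rightarrow> real"
  assumes "\<And>i. i \<in> I \<Longrightarrow> f i summable_on A"
  shows "(\<lambda>p. \<Sum>i\<in>I. f i p) summable_on A"
  using assms by (induction I rule: infinite_finite_induct) (auto intro: summable_on_add)

lemma matrix_series_abs_summable:
  assumes "matrix_diamond_summable C" "norm x + norm y < 1"
  shows "(\<lambda>p. norm (case p of (m, n) \<Rightarrow> (x ^ m * y ^ n) *\<^sub>C C m n)) summable_on UNIV"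
proof (rule Infinite_Sum.abs_summable_on_comparison_test')
  show "(\<lambda>p. \<Sum>i\<in>UNIV. \<Sum>j\<in>UNIV. norm ((\<lambda>(m, n). C m n $ i $ j * (x ^ m * y ^ n)) p)) summable_on UNIV"
    by (intro summable_on_finite_sum diamond_summableD assms
        assms(1)[unfolded matrix_diamond_summable_def, rule_format])
  show "norm ((\<lambda>(m, n). (x ^ m * y ^ n) *\<^sub>C C m n) p)
      \<le> (\<Sum>i\<in>UNIV. \<Sum>j\<in>UNIV. norm ((\<lambda>(m, n). C m n $ i $ j * (x ^ m * y ^ n)) p))" for p
    by (rule order_trans[OF norm_matrix_le_sum]) (simp add: case_prod_unfold mult.commute)
qed

text \<open>
  For fixed \<open>x\<close> and \<open>y\<close>, the relation between a family of coefficients and the value of its series.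
  Applying an operation to both sides of this relation translates a differential expression
  in \<open>U\<close> into an expression in its coefficients.
\<close>
definition has_expansion ::
    "complex \<Rightarrow> complex \<Rightarrow> (nat \<Rightarrow> nat \<Rightarrow> complex^'n^'m) \<Rightarrow> complex^'n^'m \<Rightarrow> bool"
  where "has_expansion x y C S \<longleftrightarrow> ((\<lambda>(m, n). (x ^ m * y ^ n) *\<^sub>C C m n) has_sum S) UNIV"

lemma has_expansion_matrix_series:
  assumes "matrix_diamond_summable C" "norm x + norm y < 1"
  shows "has_expansion x y C (matrix_series C x y)"
  unfolding has_expansion_def matrix_series_def
  using matrix_series_abs_summable[OF assms]
  by (rule has_sum_infsum[OF Infinite_Sum.abs_summable_summable])

lemma matrix_series_entry:
  assumes "matrix_diamond_summable C" "norm x + norm y < 1"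
  shows "matrix_series C x y $ i $ j = double_series (\<lambda>m n. C m n $ i $ j) x y"
proof -
  note has_expansion_matrix_series[OF assms, unfolded has_expansion_def]
  from has_sum_bounded_linear[OF bounded_linear_entry[of i j] this]
  have "((\<lambda>p. (case p of (m, n) \<Rightarrow> (x ^ m * y ^ n) *\<^sub>C C m n) $ i $ j)
      has_sum matrix_series C x y $ i $ j) UNIV" .
  moreover have "(\<lambda>p. (case p of (m, n) \<Rightarrow> (x ^ m * y ^ n) *\<^sub>C C m n) $ i $ j)
      = (\<lambda>(m, n). C m n $ i $ j * (x ^ m * y ^ n))"
    by (simp add: fun_eq_iff)
  ultimately have "((\<lambda>(m, n). C m n $ i $ j * (x ^ m * y ^ n)) has_sum matrix_series C x y $ i $ j) UNIV"
    by (simp only:)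
  then show ?thesis
    unfolding double_series_def by (rule infsumI[symmetric])
qed

lemma matrix_diamond_summable_diff:
  assumes "matrix_diamond_summable C"
  shows "matrix_diamond_summable (diff_left C)" "matrix_diamond_summable (diff_right C)"
  unfolding matrix_diamond_summable_def diff_left_def diff_right_def cscale_nth
  by (intro allI diamond_summable_diff_left diamond_summable_diff_right
      assms[unfolded matrix_diamond_summable_def, rule_format])+

text \<open>
  The function \<open>G\<close> is required to agree with the series only inside the region. This makes the lemma
  applicable a second time, to the partial derivatives, which are known to be series only there.
\<close>
lemma matrix_series_partial_derivatives:
  fixes G :: "complex \<Rightarrow> complex \<Rightarrow> complex^'n^'m"
  assumes G: "\<And>u v. norm u + norm v < 1 \<Longrightarrow> G u v = matrix_series C u v"
    and C: "matrix_diamond_summable C" and xy: "norm x + norm y < 1"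
  shows "partially_differentiable G x y"
    and "partial_x G x y = matrix_series (diff_left C) x y"
    and "partial_y G x y = matrix_series (diff_right C) x y"
proof -
  have entry: "diamond_summable (\<lambda>m n. C m n $ i $ j)" for i j
    using C by (simp add: matrix_diamond_summable_def)
  have Gxy: "G u v $ i $ j = double_series (\<lambda>m n. C m n $ i $ j) u v" if "norm u + norm v < 1" for u v i j
    using that by (simp add: G matrix_series_entry C)
  have evx: "eventually (\<lambda>z. G z y $ i $ j = double_series (\<lambda>m n. C m n $ i $ j) z y) (nhds x)" for i j
  proof -
    have "eventually (\<lambda>z. z \<in> ball 0 (1 - norm y)) (nhds x)"
      using xy by (intro eventually_nhds_in_open) auto
    then show ?thesis
      by eventually_elim (auto intro: Gxy)
  qed
  have evy: "eventually (\<lambda>z. G x z $ i $ j = double_series (\<lambda>m n. C m n $ i $ j) x z) (nhds y)" for i j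
  proof -
    have "eventually (\<lambda>z. z \<in> ball 0 (1 - norm x)) (nhds y)"
      using xy by (intro eventually_nhds_in_open) auto
    then show ?thesis
      by eventually_elim (auto intro: Gxy)
  qed
  have dx: "((\<lambda>z. G z y $ i $ j) has_field_derivative matrix_series (diff_left C) x y $ i $ j) (at x)" for i j
    using double_series_has_field_derivative_left[OF entry xy, of i j]
    by (subst DERIV_cong_ev[OF refl evx refl])
      (simp add: matrix_series_entry matrix_diamond_summable_diff C xy diff_left_def)
  have dy: "((\<lambda>z. G x z $ i $ j) has_field_derivative matrix_series (diff_right C) x y $ i $ j) (at y)" for i j
    using double_series_has_field_derivative_right[OF entry xy, of i j]
    by (subst DERIV_cong_ev[OF refl evy refl])
      (simp add: matrix_series_entry matrix_diamond_summable_diff C xy diff_right_def)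
  show "partially_differentiable G x y"
    unfolding partially_differentiable_def field_differentiable_def using dx dy by blast
  show "partial_x G x y = matrix_series (diff_left C) x y"
    by (simp add: vec_eq_iff partial_x_def DERIV_imp_deriv[OF dx])
  show "partial_y G x y = matrix_series (diff_right C) x y"
    by (simp add: vec_eq_iff partial_y_def DERIV_imp_deriv[OF dy])
qed

lemma matrix_series_flip:
  assumes "\<And>m n. D m n = C n m"
  shows "matrix_series D x y = matrix_series C y x"
proof -
  have "matrix_series D x y
      = (\<Sum>\<^sub>\<infinity>p. (\<lambda>(m, n). (y ^ m * x ^ n) *\<^sub>C C m n) (prod.swap p))"
    by (simp add: matrix_series_def case_prod_unfold mult.commute assms)
  also have "\<dots> = matrix_series C y x"
    unfolding matrix_series_def by (rule infsum_reindex_bij_betw[OF bij_swap])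
  finally show ?thesis .
qed

lemma has_expansion_zero_unique:
  assumes "has_expansion x y (\<lambda>m n. 0) S"
  shows "S = 0"
proof -
  have "(\<lambda>(m, n). (x ^ m * y ^ n) *\<^sub>C (0 :: complex^'n^'m)) = (\<lambda>p. 0)"
    by (simp add: fun_eq_iff vec_eq_iff)
  then have "((\<lambda>p :: nat \<times> nat. 0) has_sum S) UNIV"
    using assms[unfolded has_expansion_def] by (rule subst[of _ _ "\<lambda>f. (f has_sum S) UNIV"])
  from this has_sum_0_simp show ?thesis
    by (rule has_sum_unique)
qed

lemma has_expansion_add:
  "has_expansion x y C S \<Longrightarrow> has_expansion x y D T \<Longrightarrow> has_expansion x y (\<lambda>m n. C m n + D m n) (S + T)"
  unfolding has_expansion_def
  by (drule (1) has_sum_add) (simp add: case_prod_unfold cscale_add_right)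

lemma has_expansion_diff:
  "has_expansion x y C S \<Longrightarrow> has_expansion x y D T \<Longrightarrow> has_expansion x y (\<lambda>m n. C m n - D m n) (S - T)"
  unfolding has_expansion_def
  using has_sum_add[of "\<lambda>(m, n). (x ^ m * y ^ n) *\<^sub>C C m n" UNIV S
      "\<lambda>p. - (case p of (m, n) \<Rightarrow> (x ^ m * y ^ n) *\<^sub>C D m n)" "- T"]
  by (simp add: has_sum_uminus case_prod_unfold cscale_diff_right)

lemma has_expansion_mul_left:
  fixes C :: "nat \<Rightarrow> nat \<Rightarrow> complex^'n^'n" and X :: "complex^'n^'n"
  shows "has_expansion x y C S \<Longrightarrow> has_expansion x y (\<lambda>m n. X ** C m n) (X ** S)"
  unfolding has_expansion_def
  by (drule has_sum_bounded_linear[OF bounded_linear_matrix_mul_left[of X]]) (simp add: case_prod_unfold)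

lemma has_expansion_mul_right:
  fixes C :: "nat \<Rightarrow> nat \<Rightarrow> complex^'n^'n" and X :: "complex^'n^'n"
  shows "has_expansion x y C S \<Longrightarrow> has_expansion x y (\<lambda>m n. C m n ** X) (S ** X)"
  unfolding has_expansion_def
  by (drule has_sum_bounded_linear[OF bounded_linear_matrix_mul_right[of X]]) (simp add: case_prod_unfold)

text \<open>
  Multiplication by \<open>x\<close> moves every coefficient up by one index and leaves zeros at index 0.
\<close>
lemma has_expansion_shift_left:
  assumes "has_expansion x y C S" "D 0 = (\<lambda>n. 0)" "\<And>m n. D (Suc m) n = C m n"
  shows "has_expansion x y D (x *\<^sub>C S)"
proof -
  let ?h = "\<lambda>(m, n). (Suc m, n)" and ?g = "\<lambda>(m, n). (x ^ m * y ^ n) *\<^sub>C D m n"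
  have "((\<lambda>p. x *\<^sub>C (case p of (m, n) \<Rightarrow> (x ^ m * y ^ n) *\<^sub>C C m n)) has_sum x *\<^sub>C S) UNIV"
    using assms(1) unfolding has_expansion_def
    by (rule has_sum_bounded_linear[OF bounded_linear_cscale])
  then have "((?g \<circ> ?h) has_sum x *\<^sub>C S) UNIV"
    by (simp add: o_def case_prod_unfold assms mult_ac)
  then have "(?g has_sum x *\<^sub>C S) (range ?h)"
    by (rule has_sum_reindex[THEN iffD2, rotated]) (auto simp: inj_on_def)
  moreover have "?g p = 0" if "p \<notin> range ?h" for p
  proof (cases p)
    case (Pair m n)
    have "m = 0"
    proof (rule ccontr)
      assume "m \<noteq> 0"
      then have "p = ?h (m - 1, n)" by (simp add: Pair)
      with that show False by blast
    qed
    then show ?thesis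
      by (simp add: Pair assms vec_eq_iff)
  qed
  ultimately show ?thesis
    unfolding has_expansion_def by (subst (asm) has_sum_cong_neutral[of UNIV _ ?g]) auto
qed

lemma has_expansion_flip: "has_expansion x y (\<lambda>m n. C n m) S \<longleftrightarrow> has_expansion y x C S"
proof -
  have "((\<lambda>(m, n). (x ^ m * y ^ n) *\<^sub>C C n m) has_sum S) UNIV \<longleftrightarrow>
      ((\<lambda>p. (\<lambda>(m, n). (y ^ m * x ^ n) *\<^sub>C C m n) (prod.swap p)) has_sum S) UNIV"
    by (simp add: case_prod_unfold mult.commute)
  also have "\<dots> \<longleftrightarrow> ((\<lambda>(m, n). (y ^ m * x ^ n) *\<^sub>C C m n) has_sum S) UNIV"
    by (rule has_sum_reindex_bij_betw[OF bij_swap])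
  finally show ?thesis
    unfolding has_expansion_def .
qed

lemma has_expansion_shift_right:
  assumes "has_expansion x y C S" "\<And>m. D m 0 = 0" "\<And>m n. D m (Suc n) = C m n"
  shows "has_expansion x y D (y *\<^sub>C S)"
proof -
  have "has_expansion y x (\<lambda>n m. D m n) (y *\<^sub>C S)"
    using assms has_expansion_flip[of y x C S]
    by (intro has_expansion_shift_left[where C = "\<lambda>n m. C m n"]) auto
  then show ?thesis
    using has_expansion_flip[of x y "\<lambda>n m. D m n"] by simp
qed

text \<open>
  The Euler operator \<open>x \<partial>/\<partial>x\<close> multiplies the coefficient of \<open>x^m\<close> by \<open>m\<close>. The shift by one index has disappeared,
  so that all terms of the differential equation can be compared at the same monomial.
\<close>
lemma has_expansion_euler_left:
  assumes "has_expansion x y (diff_left C) S"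
  shows "has_expansion x y (\<lambda>m n. of_nat m *\<^sub>C C m n) (x *\<^sub>C S)"
  using assms by (rule has_expansion_shift_left) (auto simp: diff_left_def)

lemma has_expansion_euler_right:
  assumes "has_expansion x y (diff_right C) S"
  shows "has_expansion x y (\<lambda>m n. of_nat n *\<^sub>C C m n) (y *\<^sub>C S)"
  using assms by (rule has_expansion_shift_right) (auto simp: diff_right_def)

lemma has_expansion_second_left:
  assumes "has_expansion x y (diff_left (diff_left C)) S"
  shows "has_expansion x y (\<lambda>m n. (of_nat m * (of_nat m - 1)) *\<^sub>C C m n) (x\<^sup>2 *\<^sub>C S)"
proof -
  have "has_expansion x y (\<lambda>m n. (of_nat m * (of_nat m - 1)) *\<^sub>C C m n) (x *\<^sub>C x *\<^sub>C S)"
    by (rule has_expansion_shift_left[OF has_expansion_euler_left[OF assms]])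
      (auto simp: diff_left_def mult.commute)
  then show ?thesis by (simp add: power2_eq_square)
qed

lemma has_expansion_second_right:
  assumes "has_expansion x y (diff_right (diff_right C)) S"
  shows "has_expansion x y (\<lambda>m n. (of_nat n * (of_nat n - 1)) *\<^sub>C C m n) (y\<^sup>2 *\<^sub>C S)"
proof -
  have "has_expansion x y (\<lambda>m n. (of_nat n * (of_nat n - 1)) *\<^sub>C C m n) (y *\<^sub>C y *\<^sub>C S)"
    by (rule has_expansion_shift_right[OF has_expansion_euler_right[OF assms]])
      (auto simp: diff_right_def mult.commute)
  then show ?thesis by (simp add: power2_eq_square)
qed

section \<open>From the recurrence to the differential equation\<close>

text \<open>
  Write \<open>c\<close> for the coefficient of \<open>x^m y^n\<close> in \<open>U\<close> and \<open>d\<close> for the coefficient of the same monomial in \<open>\<partial>U/\<partial>x\<close>.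
  In the differential expression the terms with \<open>d\<close> come from \<open>x U\<^sub>x\<^sub>x\<close>, \<open>- y U\<^sub>x\<^sub>y\<close> and \<open>U\<^sub>x (1 - B)\<close>; they add up to
  \<open>d (m - n + 1 - B) = - d (B + (n - m - 1))\<close>. For the terms with \<open>c\<close>,
  \<open>m (m - 1) - n (n - 1) = (m - n) (m + n - 1)\<close> combines with \<open>(m - n) (A + 1)\<close> to \<open>(m - n) (A + (m + n))\<close>,
  while the terms with \<open>B'\<close> add up to \<open>(A + (m + n)) c B'\<close>. Together they give \<open>(A + (m + n)) c (B' + (m - n))\<close>, so the
  coefficient vanishes exactly when the assumed recurrence holds.
\<close>
lemma matrix_series_differential_equation:
  fixes A B B' :: "complex^'n^'n" and C :: "nat \<Rightarrow> nat \<Rightarrow> complex^'n^'n"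
  defines "U \<equiv> matrix_series C"
    and "Ux \<equiv> matrix_series (diff_left C)"
    and "Uy \<equiv> matrix_series (diff_right C)"
    and "Uxx \<equiv> matrix_series (diff_left (diff_left C))"
    and "Uxy \<equiv> matrix_series (diff_right (diff_left C))"
    and "Uyy \<equiv> matrix_series (diff_right (diff_right C))"
  assumes C: "matrix_diamond_summable C" and xy: "norm x + norm y < 1"
    and rec: "\<And>m n. diff_left C m n ** (B + mat (of_int (int n - int m - 1)))
      = (A + mat (of_nat (m + n))) ** C m n ** (B' + mat (of_int (int m - int n)))"
  shows "(x * (1 + x)) *\<^sub>C Uxx x y - y *\<^sub>C Uxy x y - y\<^sup>2 *\<^sub>C Uyy x y + Ux x y ** (mat 1 - B)
      + x *\<^sub>C ((A + mat 1) ** Ux x y) + x *\<^sub>C (Ux x y ** B') + y *\<^sub>C (Uy x y ** B')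
      - y *\<^sub>C ((A + mat 1) ** Uy x y) + A ** U x y ** B' = 0"
proof -
  note summable = matrix_diamond_summable_diff C
  let ?l = "\<lambda>m n. of_nat m *\<^sub>C diff_left C m n + (of_nat m * (of_nat m - 1)) *\<^sub>C C m n
      - of_nat n *\<^sub>C diff_left C m n - (of_nat n * (of_nat n - 1)) *\<^sub>C C m n
      + diff_left C m n ** (mat 1 - B) + (A + mat 1) ** (of_nat m *\<^sub>C C m n)
      + (of_nat m *\<^sub>C C m n) ** B' + (of_nat n *\<^sub>C C m n) ** B'
      - (A + mat 1) ** (of_nat n *\<^sub>C C m n) + A ** C m n ** B'"
  have "has_expansion x y ?l (x *\<^sub>C Uxx x y + x\<^sup>2 *\<^sub>C Uxx x y - y *\<^sub>C Uxy x y - y\<^sup>2 *\<^sub>C Uyy x y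
      + Ux x y ** (mat 1 - B) + (A + mat 1) ** (x *\<^sub>C Ux x y) + (x *\<^sub>C Ux x y) ** B'
      + (y *\<^sub>C Uy x y) ** B' - (A + mat 1) ** (y *\<^sub>C Uy x y) + A ** U x y ** B')"
    unfolding U_def Ux_def Uy_def Uxx_def Uxy_def Uyy_def
    by (intro has_expansion_add has_expansion_diff has_expansion_mul_left has_expansion_mul_right
        has_expansion_euler_left has_expansion_euler_right has_expansion_second_left
        has_expansion_second_right has_expansion_matrix_series summable xy)
  moreover have "?l m n = 0" for m n
  proof -
    define D c where "D = diff_left C m n" and "c = C m n"
    have "?l m n = (A + mat (of_nat (m + n))) ** c ** (B' + mat (of_int (int m - int n)))
        - D ** (B + mat (of_int (int n - int m - 1)))"
      unfolding D_def[symmetric] c_def[symmetric]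
      by (simp add: matrix_add_ldistrib matrix_add_rdistrib matrix_diff_ldistrib)
        (simp add: vec_eq_iff algebra_simps)
    also have "\<dots> = 0"
      unfolding D_def c_def rec by (rule diff_self)
    finally show ?thesis .
  qed
  ultimately have "x *\<^sub>C Uxx x y + x\<^sup>2 *\<^sub>C Uxx x y - y *\<^sub>C Uxy x y - y\<^sup>2 *\<^sub>C Uyy x y
      + Ux x y ** (mat 1 - B) + (A + mat 1) ** (x *\<^sub>C Ux x y) + (x *\<^sub>C Ux x y) ** B'
      + (y *\<^sub>C Uy x y) ** B' - (A + mat 1) ** (y *\<^sub>C Uy x y) + A ** U x y ** B' = 0"
    by (intro has_expansion_zero_unique[of x y]) simp
  moreover have "(x * (1 + x)) *\<^sub>C M = x *\<^sub>C M + x\<^sup>2 *\<^sub>C M" for M :: "complex^'n^'n"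
    by (simp add: vec_eq_iff algebra_simps power2_eq_square)
  ultimately show ?thesis
    by simp
qed

section \<open>The coefficients of Horn's function G1\<close>

definition G1_coeff :: "complex^'n^'n \<Rightarrow> complex^'n^'n \<Rightarrow> complex^'n^'n \<Rightarrow> nat \<Rightarrow> nat \<Rightarrow> complex^'n^'n"
  where "G1_coeff A B B' m n = (1 / (fact m * fact n)) *\<^sub>C
    (mpochhammer A (int (m + n)) ** mpochhammer B (int n - int m) ** mpochhammer B' (int m - int n))"

lemma G1_term_eq: "G1_term A B B' x y = (\<lambda>(m, n). (x ^ m * y ^ n) *\<^sub>C G1_coeff A B B' m n)"
  by (simp add: fun_eq_iff G1_term_def G1_coeff_def)

lemma G1_eq_matrix_series: "G1 A B B' = matrix_series (G1_coeff A B B')"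
  by (simp add: fun_eq_iff G1_def matrix_series_def G1_term_eq)

text \<open>
  The second differential equation is the first one for the function with \<open>B\<close> and \<open>B'\<close> exchanged and \<open>x\<close> and \<open>y\<close>
  exchanged. That this function is the same one rests on the commutation of the symbols of \<open>B\<close> and \<open>B'\<close>.
\<close>
lemma G1_coeff_flip:
  assumes "B ** B' = B' ** B" "no_positive_integer_eigenvalue B" "no_positive_integer_eigenvalue B'"
  shows "G1_coeff A B B' m n = G1_coeff A B' B n m"
proof -
  have "B ** mpochhammer B' k = mpochhammer B' k ** B" for k
    by (rule commute_mpochhammer) (use assms in auto)
  then have "mpochhammer B' k ** mpochhammer B l = mpochhammer B l ** mpochhammer B' k" for k l
    by (intro commute_mpochhammer) (use assms in auto)
  then have "mpochhammer A i ** (mpochhammer B k ** mpochhammer B' l)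
      = mpochhammer A i ** (mpochhammer B' l ** mpochhammer B k)" for i k l
    by simp
  then show ?thesis
    by (simp add: G1_coeff_def matrix_mul_assoc mult.commute add.commute)
qed

text \<open>
  Raising \<open>m\<close> by one raises the index of the symbol of \<open>A\<close>, lowers that of \<open>B\<close> and raises that of \<open>B'\<close>. The
  factor \<open>B + (n - m - 1)\<close> commutes with the symbol of \<open>B'\<close>, moves past it, and restores the index of \<open>B\<close>.
\<close>
lemma G1_coeff_recurrence:
  fixes A B B' :: "complex^'n^'n"
  assumes "B ** B' = B' ** B" "no_positive_integer_eigenvalue B" "no_positive_integer_eigenvalue B'"
  shows "diff_left (G1_coeff A B B') m n ** (B + mat (of_int (int n - int m - 1)))
    = (A + mat (of_nat (m + n))) ** G1_coeff A B B' m n ** (B' + mat (of_int (int m - int n)))"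
proof -
  define P Q R where "P = mpochhammer A (int (m + n))" and "Q = mpochhammer B (int n - int m)"
    and "R = mpochhammer B' (int m - int n)"
  define P1 Q1 R1 where "P1 = mpochhammer A (int (Suc (m + n)))"
    and "Q1 = mpochhammer B (int n - int m - 1)" and "R1 = mpochhammer B' (int m - int n + 1)"
  define S T where "S = B + mat (of_int (int n - int m - 1))" and "T = B' + mat (of_int (int m - int n))"
  have P1: "P1 = (A + mat (of_nat (m + n))) ** P"
  proof -
    have "(A + mat (of_nat (m + n))) ** A = A ** (A + mat (of_nat (m + n)))"
      by (simp add: matrix_add_ldistrib matrix_add_rdistrib)
    then show ?thesis
      unfolding P1_def P_def mpochhammer_of_nat_Suc
      by (simp only: mpochhammer_of_nat commute_mpochhammer_nat)
  qed
  have Q: "Q1 ** S = Q"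
  proof -
    have "S ** B = B ** S"
      by (simp add: S_def matrix_add_ldistrib matrix_add_rdistrib)
    with mpochhammer_rec[OF assms(2), of "int n - int m - 1"] commute_mpochhammer[OF assms(2)]
    show ?thesis
      by (simp add: S_def Q_def Q1_def)
  qed
  have R: "R1 = R ** T"
  proof -
    have "T ** B' = B' ** T"
      by (simp add: T_def matrix_add_ldistrib matrix_add_rdistrib)
    with mpochhammer_rec[OF assms(3), of "int m - int n"] commute_mpochhammer[OF assms(3)]
    show ?thesis
      by (simp add: T_def R_def R1_def)
  qed
  have RS: "R1 ** S = S ** R1"
  proof -
    have "S ** B' = B' ** S"
      by (simp add: S_def assms matrix_add_ldistrib matrix_add_rdistrib)
    then show ?thesis
      unfolding R1_def using commute_mpochhammer[OF assms(3)] by metis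
  qed
  have "diff_left (G1_coeff A B B') m n = (1 / (fact m * fact n)) *\<^sub>C (P1 ** Q1 ** R1)"
  proof -
    have "int n - int (Suc m) = int n - int m - 1" "int (Suc m) - int n = int m - int n + 1"
      by auto
    moreover have "of_nat (Suc m) * (1 / (fact (Suc m) * fact n)) = (1 / (fact m * fact n) :: complex)"
      by (simp add: divide_simps del: of_nat_Suc)
    ultimately show ?thesis
      by (simp only: diff_left_def G1_coeff_def cscale_cscale P1_def Q1_def R1_def add_Suc)
  qed
  moreover have "P1 ** Q1 ** R1 ** S = (A + mat (of_nat (m + n))) ** (P ** Q ** R) ** T"
  proof -
    have "P1 ** Q1 ** R1 ** S = P1 ** Q1 ** (R1 ** S)"
      by (simp only: matrix_mul_assoc)
    also have "\<dots> = P1 ** (Q1 ** S) ** R1"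
      unfolding RS by (simp only: matrix_mul_assoc)
    also have "\<dots> = (A + mat (of_nat (m + n))) ** (P ** Q ** R) ** T"
      unfolding P1 Q R by (simp only: matrix_mul_assoc)
    finally show ?thesis .
  qed
  moreover have "G1_coeff A B B' m n = (1 / (fact m * fact n)) *\<^sub>C (P ** Q ** R)"
    by (simp add: G1_coeff_def P_def Q_def R_def)
  ultimately show ?thesis
    unfolding S_def[symmetric] T_def[symmetric] by simp
qed

text \<open>
  The symbol of \<open>A\<close> contributes \<open>(m + n)!\<close>, the other two symbols contribute no factorial, and division by
  \<open>m! n!\<close> leaves a binomial coefficient. All remaining factors are subexponential.
\<close>
lemma matrix_diamond_summable_G1_coeff:
  fixes A B B' :: "complex^'n^'n"
  assumes "no_positive_integer_eigenvalue B" "no_positive_integer_eigenvalue B'"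
  shows "matrix_diamond_summable (G1_coeff A B B')"
  unfolding matrix_diamond_summable_def
proof (intro allI diamond_summableI_binomial)
  fix i j and q :: real
  assume "1 < q"
  \<comment> \<open>One factor \<open>r^(m + n)\<close> is spent on the symbol of \<open>A\<close> and, since \<open>|n - m| \<le> m + n\<close>, two more on
     the other symbols.\<close>
  define r where "r = root 3 q"
  have r: "1 < r" "r ^ 3 = q"
    using \<open>1 < q\<close> by (auto simp: r_def real_root_pow_pos2)
  obtain K where K: "0 \<le> K" "\<And>k. opnorm (mpochhammer A (int k)) \<le> K * r ^ k * fact k"
    using mpochhammer_of_nat_growth r by metis
  obtain L where L: "0 \<le> L"
    "\<And>k. opnorm (mpochhammer B k) * opnorm (mpochhammer B' (- k)) \<le> L * r ^ (2 * nat \<bar>k\<bar>)"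
    using opposite_mpochhammer_growth assms r by metis
  have "norm (G1_coeff A B B' m n $ i $ j) \<le> K * L * q ^ (m + n) * real ((m + n) choose m)" for m n
  proof -
    let ?P = "mpochhammer A (int (m + n))" and ?Q = "mpochhammer B (int n - int m)"
      and ?R = "mpochhammer B' (int m - int n)"
    have "norm ((?P ** ?Q ** ?R) $ i $ j) \<le> opnorm (?P ** ?Q ** ?R)"
      by (rule norm_entry_le_opnorm)
    also have "\<dots> \<le> opnorm ?P * (opnorm ?Q * opnorm ?R)"
      unfolding matrix_mul_assoc[symmetric]
      by (intro order_trans[OF opnorm_matrix_mul] mult_left_mono opnorm_matrix_mul opnorm_nonneg)
    also have "\<dots> \<le> (K * r ^ (m + n) * fact (m + n)) * (L * r ^ (2 * (m + n)))"
    proof (rule mult_mono)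
      show "opnorm ?P \<le> K * r ^ (m + n) * fact (m + n)"
        by (rule K)
    next
      have "opnorm ?Q * opnorm ?R \<le> L * r ^ (2 * nat \<bar>int n - int m\<bar>)"
        using L(2)[of "int n - int m"] by simp
      also have "\<dots> \<le> L * r ^ (2 * (m + n))"
        using r L by (intro mult_left_mono power_increasing) auto
      finally show "opnorm ?Q * opnorm ?R \<le> L * r ^ (2 * (m + n))" .
    next
      show "0 \<le> K * r ^ (m + n) * fact (m + n)"
        using K r by simp
      show "0 \<le> opnorm ?Q * opnorm ?R"
        by (intro mult_nonneg_nonneg opnorm_nonneg)
    qed
    also have "\<dots> = K * L * q ^ (m + n) * fact (m + n)"
      by (simp add: r(2)[symmetric] power_mult[symmetric] power_add[symmetric])
    finally have "norm ((?P ** ?Q ** ?R) $ i $ j) / (fact m * fact n)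
        \<le> K * L * q ^ (m + n) * fact (m + n) / (fact m * fact n)"
      by (rule divide_right_mono) simp
    then show ?thesis
      by (simp add: G1_coeff_def norm_mult norm_divide binomial_fact)
  qed
  then show "\<exists>K. \<forall>m n. norm (G1_coeff A B B' m n $ i $ j) \<le> K * q ^ (m + n) * real ((m + n) choose m)"
    by blast
qed

theorem theorem3p2:
  fixes A B B' :: "complex^'d^'d" and x y :: complex
  assumes "B ** B' = B' ** B"
    and "\<And>k::nat. 1 \<le> k \<Longrightarrow> \<not> eigenvalue_of B (of_nat k)"
    and "\<And>k::nat. 1 \<le> k \<Longrightarrow> \<not> eigenvalue_of B' (of_nat k)"
    and "norm x + norm y < 1"
  shows "(\<lambda>p. norm (G1_term A B B' x y p)) summable_on UNIV \<and>
    (let F = G1 A B B';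
         I = mat 1;
         U = F x y;
         Ux = partial_x F x y;
         Uy = partial_y F x y;
         Uxx = partial_x (partial_x F) x y;
         Uxy = partial_y (partial_x F) x y;
         Uyy = partial_y (partial_y F) x y
     in partially_differentiable F x y \<and>
        partially_differentiable (partial_x F) x y \<and>
        partially_differentiable (partial_y F) x y \<and>
        (x * (1 + x)) *\<^sub>C Uxx - y *\<^sub>C Uxy - y\<^sup>2 *\<^sub>C Uyy + Ux ** (I - B) + x *\<^sub>C ((A + I) ** Ux)
          + x *\<^sub>C (Ux ** B') + y *\<^sub>C (Uy ** B') - y *\<^sub>C ((A + I) ** Uy) + A ** U ** B' = 0 \<and>
        (y * (1 + y)) *\<^sub>C Uyy - x *\<^sub>C Uxy - x\<^sup>2 *\<^sub>C Uxx + Uy ** (I - B') + y *\<^sub>C ((A + I) ** Uy)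
          + y *\<^sub>C (Uy ** B) + x *\<^sub>C (Ux ** B) - x *\<^sub>C ((A + I) ** Ux) + A ** U ** B = 0)"
proof -
  have B: "no_positive_integer_eigenvalue B" and B': "no_positive_integer_eigenvalue B'"
    using assms by auto
  define C C' where "C = G1_coeff A B B'" and "C' = G1_coeff A B' B"
  have C: "matrix_diamond_summable C" and C': "matrix_diamond_summable C'"
    unfolding C_def C'_def by (intro matrix_diamond_summable_G1_coeff B B')+
  have F: "G1 A B B' u v = matrix_series C u v" for u v
    by (simp add: G1_eq_matrix_series C_def)
  note dF = matrix_series_partial_derivatives[OF F C]
  have dFx: "partially_differentiable (partial_x (G1 A B B')) x y"
    "partial_x (partial_x (G1 A B B')) x y = matrix_series (diff_left (diff_left C)) x y"
    "partial_y (partial_x (G1 A B B')) x y = matrix_series (diff_right (diff_left C)) x y"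
    by (rule matrix_series_partial_derivatives[OF _ matrix_diamond_summable_diff(1)[OF C] assms(4)],
        rule dF(2), assumption)+
  have dFy: "partially_differentiable (partial_y (G1 A B B')) x y"
    "partial_y (partial_y (G1 A B B')) x y = matrix_series (diff_right (diff_right C)) x y"
    by (rule matrix_series_partial_derivatives[OF _ matrix_diamond_summable_diff(2)[OF C] assms(4)],
        rule dF(3), assumption)+
  have flip: "C' m n = C n m" for m n
    unfolding C_def C'_def using assms B B' by (intro G1_coeff_flip) auto
  \<comment> \<open>The mixed derivative appears on both sides: the coefficients of the two iterated
     derivatives coincide, so the order of differentiation is immaterial.\<close>
  have d: "matrix_series C' y x = matrix_series C x y"
    "matrix_series (diff_left C') y x = matrix_series (diff_right C) x y"
    "matrix_series (diff_right C') y x = matrix_series (diff_left C) x y"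
    "matrix_series (diff_left (diff_left C')) y x = matrix_series (diff_right (diff_right C)) x y"
    "matrix_series (diff_right (diff_left C')) y x = matrix_series (diff_right (diff_left C)) x y"
    "matrix_series (diff_right (diff_right C')) y x = matrix_series (diff_left (diff_left C)) x y"
    by (rule matrix_series_flip; simp add: diff_left_def diff_right_def flip mult.commute)+
  have sum: "(\<lambda>p. norm (G1_term A B B' x y p)) summable_on UNIV"
    unfolding G1_term_eq C_def[symmetric] by (rule matrix_series_abs_summable[OF C assms(4)])
  have eq1: "(x * (1 + x)) *\<^sub>C matrix_series (diff_left (diff_left C)) x y
      - y *\<^sub>C matrix_series (diff_right (diff_left C)) x y - y\<^sup>2 *\<^sub>C matrix_series (diff_right (diff_right C)) x y
      + matrix_series (diff_left C) x y ** (mat 1 - B) + x *\<^sub>C ((A + mat 1) ** matrix_series (diff_left C) x y)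
      + x *\<^sub>C (matrix_series (diff_left C) x y ** B') + y *\<^sub>C (matrix_series (diff_right C) x y ** B')
      - y *\<^sub>C ((A + mat 1) ** matrix_series (diff_right C) x y) + A ** matrix_series C x y ** B' = 0"
    using C assms(4) unfolding C_def
    by (rule matrix_series_differential_equation) (rule G1_coeff_recurrence[OF assms(1) B B'])
  have eq2: "(y * (1 + y)) *\<^sub>C matrix_series (diff_right (diff_right C)) x y
      - x *\<^sub>C matrix_series (diff_right (diff_left C)) x y - x\<^sup>2 *\<^sub>C matrix_series (diff_left (diff_left C)) x y
      + matrix_series (diff_right C) x y ** (mat 1 - B') + y *\<^sub>C ((A + mat 1) ** matrix_series (diff_right C) x y)
      + y *\<^sub>C (matrix_series (diff_right C) x y ** B) + x *\<^sub>C (matrix_series (diff_left C) x y ** B)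
      - x *\<^sub>C ((A + mat 1) ** matrix_series (diff_left C) x y) + A ** matrix_series C x y ** B = 0"
  proof -
    have yx: "norm y + norm x < 1"
      using assms(4) by simp
    have "\<And>m n. diff_left C' m n ** (B' + mat (of_int (int n - int m - 1)))
        = (A + mat (of_nat (m + n))) ** C' m n ** (B + mat (of_int (int m - int n)))"
      unfolding C'_def by (rule G1_coeff_recurrence[OF assms(1)[symmetric] B' B])
    from matrix_series_differential_equation[OF C' yx this]
    show ?thesis
      unfolding d .
  qed
  show ?thesis
    unfolding Let_def dFx(2,3) dFy(2) dF(2,3)[OF assms(4)] F[of x y]
    by (intro conjI sum eq1 eq2 dF(1)[OF assms(4)] dFx(1) dFy(1))
qed

end
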